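(* Let $F:\mathbb{R}\to\mathbb{R}$ and $\varepsilon:\mathbb{R}^2\to\mathbb{R}$ be smooth functions. The map $\tilde H^{-2}:(x,y)\mapsto(\bar x,\bar y)$ of the form $$\bar x=-x+F(\bar y)+\varepsilon(x,\bar y),\qquad \bar y=-y+F(x)+\varepsilon(\bar y,x)$$ is reversible with respect to the involution $h:(x,y)\mapsto(y,x)$. The Jacobian of $\tilde H^{-2}$ at $(x,y)$ (wherever the relations define a smooth map on an open set) is $$J=\frac{1-\varepsilon_x(x,\bar y)}{1-\varepsilon_x(\bar y,x)}.$$
   Context: $\tilde H^{-2}$ is just the name of the map defined by the displayed relations; for $\varepsilon\equiv0$ it is $H^{-1}\circ H^{-1}$, where $H:\ \bar x=y,\ \bar y=-x+F(y)$. A diffeomorphism $f$ is reversible with respect to an involution $h$ ($h^2=\mathrm{Id}$) if $f=h\circ f^{-1}\circ h$. Since the map here is given implicitly, it is identified with its graph, i.e. the set of pairs $((x,y),(\bar x,\bar y))$ satisfying the two relations; $f^{-1}$ is the inverse relation, and $f=h\circ f^{-1}\circ h$ is understood as equality of graphs (that is, $(p,q)$ belongs to the graph if and only if $(h(q),h(p))$ does). When the relations define a diffeomorphism this is the usual notion. The subscript $x$ on a function of two variables denotes differentiation with respect to its first argument, evaluated at the indicated point. The Jacobian is the determinant $J=\frac{\partial\bar x}{\partial x}\frac{\partial\bar y}{\partial y}-\frac{\partial\bar x}{\partial y}\frac{\partial\bar y}{\partial x}$. *)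

theory Defs
  imports "HOL-Analysis.Analysis"
begin

(* C^k on an open set S, by recursion on directional derivatives: in finite dimension, f is
   C^(k+1) iff it is differentiable and every directional derivative is C^k. *)
primrec Ck_on :: "nat \<Rightarrow> ('a::euclidean_space \<Rightarrow> 'b::euclidean_space) \<Rightarrow> 'a set \<Rightarrow> bool" where
  "Ck_on 0 f S \<longleftrightarrow> continuous_on S f"
| "Ck_on (Suc k) f S \<longleftrightarrow>
     (\<forall>p\<in>S. f differentiable (at p)) \<and>
     (\<forall>v. Ck_on k (\<lambda>p. frechet_derivative f (at p) v) S)"

definition smooth_on :: "('a::euclidean_space \<Rightarrow> 'b::euclidean_space) \<Rightarrow> 'a set \<Rightarrow> bool" where
  "smooth_on f S \<longleftrightarrow> (\<forall>k. Ck_on k f S)"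

definition fun_graph :: "('a \<Rightarrow> 'b) \<Rightarrow> ('a \<times> 'b) set" where
  "fun_graph f = {(p, f p) | p. True}"

definition H2_graph :: "(real \<Rightarrow> real) \<Rightarrow> (real \<times> real \<Rightarrow> real)
    \<Rightarrow> ((real \<times> real) \<times> (real \<times> real)) set" where
  "H2_graph F \<epsilon> = {((x, y), (x', y')) | x y x' y'.
     x' = - x + F y' + \<epsilon> (x, y') \<and>
     y' = - y + F x + \<epsilon> (y', x)}"

(* f = h o f^(-1) o h, read as an equality of graphs so that f may be a relation. *)
definition reversible_wrt :: "('a \<Rightarrow> 'a) \<Rightarrow> ('a \<times> 'a) set \<Rightarrow> bool" where
  "reversible_wrt h R \<longleftrightarrow> h \<circ> h = id \<and> R = fun_graph h O R\<inverse> O fun_graph h"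

lemma reversible_wrt_iff:
  "reversible_wrt h R \<longleftrightarrow> h \<circ> h = id \<and> (\<forall>p q. (p, q) \<in> R \<longleftrightarrow> (h q, h p) \<in> R)"
proof (cases "h \<circ> h = id")
  case True
  then have hh: "h (h z) = z" for z by (metis comp_apply id_apply)
  have "(p, q) \<in> fun_graph h O R\<inverse> O fun_graph h \<longleftrightarrow> (h q, h p) \<in> R" for p q
    unfolding fun_graph_def relcomp_unfold using hh by auto
  then show ?thesis
    unfolding reversible_wrt_def using True by (simp add: set_eq_iff)
qed (simp add: reversible_wrt_def)

definition partial1 :: "(real \<times> real \<Rightarrow> real) \<Rightarrow> real \<times> real \<Rightarrow> real" where
  "partial1 g p = deriv (\<lambda>t. g (t, snd p)) (fst p)"

definition partial2 :: "(real \<times> real \<Rightarrow> real) \<Rightarrow> real \<times> real \<Rightarrow> real" where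
  "partial2 g p = deriv (\<lambda>t. g (fst p, t)) (snd p)"

definition Jacobian :: "(real \<times> real \<Rightarrow> real \<times> real) \<Rightarrow> real \<times> real \<Rightarrow> real" where
  "Jacobian f p =
     partial1 (fst \<circ> f) p * partial2 (snd \<circ> f) p -
     partial2 (fst \<circ> f) p * partial1 (snd \<circ> f) p"

end

theory Submission
  imports Defs
begin

text \<open>Replacing \<open>(x, y, x', y')\<close> by \<open>(y', x', y, x)\<close> turns each of the two relations into the
  other one, with the unprimed and the primed variable outside \<open>F\<close> and \<open>\<epsilon>\<close> moved across the
  equality sign; this is reversibility.

  For the Jacobian, write \<open>X\<close>, \<open>Y\<close> for the components of the map and differentiate the relations
  along an arbitrary direction \<open>(a, b)\<close>, which gives the lemma \<open>linearized_relations\<close>. In the first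
  relation the dependence of \<open>X\<close> on \<open>(x, y)\<close> is \<open>X = G (x, Y)\<close> with
  \<open>G (s, t) = - s + F t + \<epsilon> (s, t)\<close>, so the multiple of the gradient of \<open>Y\<close> contributed by the second
  argument of \<open>G\<close> drops out of the determinant, leaving \<open>J = (\<epsilon>\<^sub>x (x, Y) - 1) Y\<^sub>y\<close>. The second
  relation, differentiated in \<open>y\<close>, reads \<open>Y\<^sub>y (1 - \<epsilon>\<^sub>x (Y, x)) = -1\<close>. This shows both that the
  denominator cannot vanish wherever a smooth solution exists and what \<open>Y\<^sub>y\<close> is.\<close>

lemma mem_H2_graph_iff:
  "((x, y), (x', y')) \<in> H2_graph F \<epsilon> \<longleftrightarrow>
    x' = - x + F y' + \<epsilon> (x, y') \<and> y' = - y + F x + \<epsilon> (y', x)"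
  unfolding H2_graph_def by blast

lemma smooth_on_imp_differentiable:
  assumes "smooth_on f S" and "p \<in> S"
  shows "f differentiable (at p)"
proof -
  have "Ck_on (Suc 0) f S"
    using assms(1) unfolding smooth_on_def by blast
  then show ?thesis
    using assms(2) by simp
qed

text \<open>The derivative at \<open>p\<close> is determined by its values on the coordinate directions, and those
  values are the partial derivatives because differentiability makes the one-variable restrictions
  differentiable.\<close>

lemma has_derivative_partials:
  fixes g :: "real \<times> real \<Rightarrow> real"
  assumes "g differentiable (at p)"
  shows "(g has_derivative (\<lambda>v. partial1 g p * fst v + partial2 g p * snd v)) (at p)"
proof -
  obtain a b where p: "p = (a, b)"
    by (cases p)
  obtain G where G: "(g has_derivative G) (at (a, b))"
    using assms unfolding differentiable_def p by blast
  then interpret G: linear G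
    by (rule has_derivative_linear)
  define c d where "c = G (1, 0)" and "d = G (0, 1)"
  have G_axis: "G (h, 0) = c * h" "G (0, h) = d * h" for h
    using G.scale[of h "(1, 0)"] G.scale[of h "(0, 1)"] by (simp_all add: c_def d_def)
  have "((\<lambda>t. g (t, b)) has_derivative (\<lambda>h. G (h, 0))) (at a)"
    by (rule has_derivative_compose[of "\<lambda>t. (t, b)", OF _ G])
       (auto intro!: derivative_eq_intros)
  then have p1: "partial1 g p = c"
    unfolding partial1_def p fst_conv snd_conv
    by (intro DERIV_imp_deriv) (simp add: has_field_derivative_def G_axis)
  have "((\<lambda>t. g (a, t)) has_derivative (\<lambda>h. G (0, h))) (at b)"
    by (rule has_derivative_compose[of "\<lambda>t. (a, t)", OF _ G])
       (auto intro!: derivative_eq_intros)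
  then have p2: "partial2 g p = d"
    unfolding partial2_def p fst_conv snd_conv
    by (intro DERIV_imp_deriv) (simp add: has_field_derivative_def G_axis)
  have "G v = partial1 g p * fst v + partial2 g p * snd v" for v
    using G.add[of "(fst v, 0)" "(0, snd v)"] by (simp add: p1 p2 G_axis)
  then have "G = (\<lambda>v. partial1 g p * fst v + partial2 g p * snd v)"
    by (rule ext)
  then show ?thesis
    using G p by simp
qed

lemma DERIV_compose_partials:
  fixes g :: "real \<times> real \<Rightarrow> real"
  assumes "g differentiable (at (u t, v t))"
    and "(u has_real_derivative u') (at t)" and "(v has_real_derivative v') (at t)"
  shows "((\<lambda>s. g (u s, v s)) has_real_derivative
      partial1 g (u t, v t) * u' + partial2 g (u t, v t) * v') (at t)"
proof -
  have "((\<lambda>s. (u s, v s)) has_derivative (\<lambda>h. (u' * h, v' * h))) (at t)"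
    using assms(2,3) unfolding has_field_derivative_def by (rule has_derivative_Pair)
  from has_derivative_compose[OF this has_derivative_partials[OF assms(1)]]
  show ?thesis
    unfolding has_field_derivative_def
    by (rule has_derivative_eq_rhs) (simp add: fun_eq_iff algebra_simps)
qed

text \<open>Differentiating along an arbitrary direction treats both partial derivatives at once: the
  coordinate directions recover the partial derivatives of the two relations.\<close>

lemma linearized_relations:
  fixes F :: "real \<Rightarrow> real" and \<epsilon> :: "real \<times> real \<Rightarrow> real"
    and f :: "real \<times> real \<Rightarrow> real \<times> real"
  assumes F: "\<And>t. F differentiable (at t)" and \<epsilon>: "\<And>q. \<epsilon> differentiable (at q)"
    and "open U" and "(x, y) \<in> U" and f: "f differentiable (at (x, y))"
    and graph: "\<And>p. p \<in> U \<Longrightarrow> (p, f p) \<in> H2_graph F \<epsilon>"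
  defines "X \<equiv> fst \<circ> f" and "Y \<equiv> snd \<circ> f"
  defines "DX \<equiv> \<lambda>a b. partial1 X (x, y) * a + partial2 X (x, y) * b"
    and "DY \<equiv> \<lambda>a b. partial1 Y (x, y) * a + partial2 Y (x, y) * b"
  shows "DX a b = - a + deriv F (Y (x, y)) * DY a b
      + (partial1 \<epsilon> (x, Y (x, y)) * a + partial2 \<epsilon> (x, Y (x, y)) * DY a b)"
    and "DY a b = - b + deriv F x * a
      + (partial1 \<epsilon> (Y (x, y), x) * DY a b + partial2 \<epsilon> (Y (x, y), x) * a)"
proof -
  define u v where "u = (\<lambda>s. x + s * a)" and "v = (\<lambda>s. y + s * b)"
  have uv0: "u 0 = x" "v 0 = y"
    by (simp_all add: u_def v_def)
  have du: "(u has_real_derivative a) (at 0)" and dv: "(v has_real_derivative b) (at 0)"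
    unfolding u_def v_def by (auto intro!: derivative_eq_intros)
  have XY: "X differentiable (at (x, y))" "Y differentiable (at (x, y))"
    using has_derivative_fst[of f] has_derivative_snd[of f] f
    unfolding X_def Y_def comp_def differentiable_def by fast+
  have dX: "((\<lambda>s. X (u s, v s)) has_real_derivative DX a b) (at 0)"
    using DERIV_compose_partials[of X u 0 v, OF _ du dv] XY by (simp add: uv0 DX_def)
  have dY: "((\<lambda>s. Y (u s, v s)) has_real_derivative DY a b) (at 0)"
    using DERIV_compose_partials[of Y u 0 v, OF _ du dv] XY by (simp add: uv0 DY_def)
  have dF: "(F has_real_derivative deriv F t) (at t)" for t
    using F[of t] by (metis DERIV_imp_deriv real_differentiable_def)
  have dFY: "((\<lambda>s. F (Y (u s, v s))) has_real_derivative deriv F (Y (x, y)) * DY a b) (at 0)"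
    using DERIV_chain2[OF dF dY] by (simp add: uv0)
  have dFu: "((\<lambda>s. F (u s)) has_real_derivative deriv F x * a) (at 0)"
    using DERIV_chain2[OF dF du] by (simp add: uv0)
  have d1: "((\<lambda>s. \<epsilon> (u s, Y (u s, v s))) has_real_derivative
      partial1 \<epsilon> (x, Y (x, y)) * a + partial2 \<epsilon> (x, Y (x, y)) * DY a b) (at 0)"
    using DERIV_compose_partials[OF \<epsilon> du dY] by (simp add: uv0)
  have d2: "((\<lambda>s. \<epsilon> (Y (u s, v s), u s)) has_real_derivative
      partial1 \<epsilon> (Y (x, y), x) * DY a b + partial2 \<epsilon> (Y (x, y), x) * a) (at 0)"
    using DERIV_compose_partials[OF \<epsilon> dY du] by (simp add: uv0)
  \<comment> \<open>Near \<open>s = 0\<close> the line stays in \<open>U\<close>, so the relations are identities in \<open>s\<close> there.\<close>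
  have "isCont (\<lambda>s. (u s, v s)) 0"
    unfolding u_def v_def by (intro continuous_intros)
  then have "((\<lambda>s. (u s, v s)) \<longlongrightarrow> (x, y)) (nhds 0)"
    using tendsto_at_iff_tendsto_nhds[of "\<lambda>s. (u s, v s)" 0] by (simp add: isCont_def uv0)
  then have "\<forall>\<^sub>F s in nhds 0. (u s, v s) \<in> U"
    using assms(3,4) by (rule topological_tendstoD)
  moreover have "X (p, q) = - p + F (Y (p, q)) + \<epsilon> (p, Y (p, q))"
    "Y (p, q) = - q + F p + \<epsilon> (Y (p, q), p)" if "(p, q) \<in> U" for p q
    using graph[OF that] by (cases "f (p, q)"; simp add: mem_H2_graph_iff X_def Y_def)+
  ultimately have
    eX: "\<forall>\<^sub>F s in nhds 0. X (u s, v s) = - u s + F (Y (u s, v s)) + \<epsilon> (u s, Y (u s, v s))" and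
    eY: "\<forall>\<^sub>F s in nhds 0. Y (u s, v s) = - v s + F (u s) + \<epsilon> (Y (u s, v s), u s)"
    by (auto elim!: eventually_mono)
  show "DX a b = - a + deriv F (Y (x, y)) * DY a b
      + (partial1 \<epsilon> (x, Y (x, y)) * a + partial2 \<epsilon> (x, Y (x, y)) * DY a b)"
    using dX[unfolded DERIV_cong_ev[OF refl eX refl]]
      DERIV_add[OF DERIV_add[OF DERIV_minus[OF du] dFY] d1]
    by (rule DERIV_unique)
  show "DY a b = - b + deriv F x * a
      + (partial1 \<epsilon> (Y (x, y), x) * DY a b + partial2 \<epsilon> (Y (x, y), x) * a)"
    using dY[unfolded DERIV_cong_ev[OF refl eY refl]]
      DERIV_add[OF DERIV_add[OF DERIV_minus[OF dv] dFu] d2]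
    by (rule DERIV_unique)
qed

lemma H2_graph_reversible: "reversible_wrt prod.swap (H2_graph F \<epsilon>)"
proof -
  have "((x, y), (x', y')) \<in> H2_graph F \<epsilon> \<longleftrightarrow> ((y', x'), (y, x)) \<in> H2_graph F \<epsilon>" for x y x' y'
    unfolding mem_H2_graph_iff by (intro iffI conjI; elim conjE; linarith)
  then show ?thesis
    unfolding reversible_wrt_iff by (simp add: fun_eq_iff split_paired_all)
qed

theorem lemma4:
  fixes F :: "real \<Rightarrow> real" and \<epsilon> :: "real \<times> real \<Rightarrow> real"
  assumes "smooth_on F UNIV" and "smooth_on \<epsilon> UNIV"
  shows "reversible_wrt prod.swap (H2_graph F \<epsilon>) \<and>
    (\<forall>U f. open U \<and> smooth_on f U \<and> (\<forall>p\<in>U. (p, f p) \<in> H2_graph F \<epsilon>) \<longrightarrow>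
      (\<forall>x y x' y'. (x, y) \<in> U \<and> f (x, y) = (x', y') \<longrightarrow>
        1 - partial1 \<epsilon> (y', x) \<noteq> 0 \<and>
        Jacobian f (x, y) = (1 - partial1 \<epsilon> (x, y')) / (1 - partial1 \<epsilon> (y', x))))"
proof (intro conjI[OF H2_graph_reversible] allI impI, elim conjE)
  fix U f x y x' y'
  assume U: "open U" "(x, y) \<in> U" and f: "smooth_on f U" "f (x, y) = (x', y')"
    and graph: "\<forall>p\<in>U. (p, f p) \<in> H2_graph F \<epsilon>"
  have "F differentiable (at t)" "\<epsilon> differentiable (at q)" "f differentiable (at (x, y))" for t q
    using assms f(1) U(2) by (auto intro: smooth_on_imp_differentiable)
  note lin = linearized_relations[OF this(1,2) U this(3) graph[rule_format]]
  define Xx Xy Yx Yy where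
    "Xx = partial1 (fst \<circ> f) (x, y)" and "Xy = partial2 (fst \<circ> f) (x, y)" and
    "Yx = partial1 (snd \<circ> f) (x, y)" and "Yy = partial2 (snd \<circ> f) (x, y)"
  note defs = Xx_def[symmetric] Xy_def[symmetric] Yx_def[symmetric] Yy_def[symmetric]
  \<comment> \<open>The coefficient with which the gradient of the second component enters that of the first.\<close>
  define c where "c = deriv F y' + partial2 \<epsilon> (x, y')"
  have X: "Xx = partial1 \<epsilon> (x, y') - 1 + c * Yx" "Xy = c * Yy"
    using lin(1)[of 1 0] lin(1)[of 0 1] by (simp_all add: defs c_def f(2) algebra_simps)
  have Y: "Yy * (1 - partial1 \<epsilon> (y', x)) = - 1"
    using lin(2)[of 0 1] by (simp add: defs f(2) algebra_simps)
  have nz: "1 - partial1 \<epsilon> (y', x) \<noteq> 0"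
    using Y by auto
  then have Yy: "Yy = - 1 / (1 - partial1 \<epsilon> (y', x))"
    by (rule iffD2[OF nonzero_eq_divide_eq Y])
  have "Jacobian f (x, y) = Xx * Yy - Xy * Yx"
    by (simp add: Jacobian_def defs)
  also have "\<dots> = (partial1 \<epsilon> (x, y') - 1) * Yy"
    by (simp add: X algebra_simps)
  also have "\<dots> = (1 - partial1 \<epsilon> (x, y')) / (1 - partial1 \<epsilon> (y', x))"
    using nz by (simp add: Yy divide_simps)
  finally show "1 - partial1 \<epsilon> (y', x) \<noteq> 0 \<and>
      Jacobian f (x, y) = (1 - partial1 \<epsilon> (x, y')) / (1 - partial1 \<epsilon> (y', x))"
    using nz by simp
qed

end
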